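(* Let $(X,\circ,\backslash_{\circ},\bullet,/_{\bullet})$ be a birack (not necessarily involutive, and with $X$ of arbitrary cardinality). Let $\approx$ be the equivalence relation on $X$ (the generalized retraction) defined by $$x\approx y \iff \text{for all } z\in X:\ x\circ z=y\circ z \ \text{ and } \ z\bullet x=z\bullet y .$$ Then $\approx$ is a congruence of the birack $(X,\circ,\backslash_{\circ},\bullet,/_{\bullet})$; that is, whenever $a,b,c,d\in X$ satisfy $a\approx b$ and $c\approx d$, one has $$a\circ c\approx b\circ d,\qquad a\backslash_{\circ}c\approx b\backslash_{\circ}d,\qquad a\bullet c\approx b\bullet d,\qquad a/_{\bullet}c\approx b/_{\bullet}d .$$
   Context: A birack is an algebra $(X,\circ,\backslash_{\circ},\bullet,/_{\bullet})$ consisting of a non-empty set $X$ with four binary operations such that: (1) $(X,\circ,\backslash_{\circ})$ is a left quasigroup: for all $x,y\in X$, $x\circ(x\backslash_{\circ}y)=y$ and $x\backslash_{\circ}(x\circ y)=y$ (equivalently, every left translation $L_x\colon X\to X$, $L_x(a)=x\circ a$, is a bijection, and $x\backslash_{\circ}y=L_x^{-1}(y)$); (2) $(X,\bullet,/_{\bullet})$ is a right quasigroup: for all $x,y\in X$, $(y/_{\bullet}x)\bullet x=y$ and $(y\bullet x)/_{\bullet}x=y$ (equivalently, every right translation $\mathbf{R}_x\colon X\to X$, $\mathbf{R}_x(a)=a\bullet x$, is a bijection, and $y/_{\bullet}x=\mathbf{R}_x^{-1}(y)$); (3) for all $x,y,z\in X$: $$x\circ(y\circ z)=(x\circ y)\circ((x\bullet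 y)\circ z),$$ $$(x\circ y)\bullet((x\bullet y)\circ z)=(x\bullet(y\circ z))\circ(y\bullet z),$$ $$(x\bullet y)\bullet z=(x\bullet(y\circ z))\bullet(y\bullet z).$$ In terms of translations, the generalized retraction is: $x\approx y$ if and only if $L_x=L_y$ and $\mathbf{R}_x=\mathbf{R}_y$. A congruence of a birack is an equivalence relation on $X$ compatible with all four operations $\circ,\backslash_{\circ},\bullet,/_{\bullet}$. *)

theory Defs imports Main begin

text \<open>
  The carrier \<open>X\<close> is an arbitrary non-empty set closed under the four operations; nothing is assumed
  about the values of the operations outside \<open>X\<close>.
\<close>

locale birack =
  fixes X :: "'a set"
    and lmul :: "'a \<Rightarrow> 'a \<Rightarrow> 'a"  (infixl "\<^bold>\<circ>" 70)
    and ldiv :: "'a \<Rightarrow> 'a \<Rightarrow> 'a"  (infixl "\<setminus>\<^sub>\<circ>" 70)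
    and rmul :: "'a \<Rightarrow> 'a \<Rightarrow> 'a"  (infixl "\<^bold>\<bullet>" 70)
    and rdiv :: "'a \<Rightarrow> 'a \<Rightarrow> 'a"  (infixl "'/\<^sub>\<bullet>" 70)
  assumes nonempty: "X \<noteq> {}"
    and lmul_closed: "\<lbrakk>x \<in> X; y \<in> X\<rbrakk> \<Longrightarrow> x \<^bold>\<circ> y \<in> X"
    and ldiv_closed: "\<lbrakk>x \<in> X; y \<in> X\<rbrakk> \<Longrightarrow> x \<setminus>\<^sub>\<circ> y \<in> X"
    and rmul_closed: "\<lbrakk>x \<in> X; y \<in> X\<rbrakk> \<Longrightarrow> x \<^bold>\<bullet> y \<in> X"
    and rdiv_closed: "\<lbrakk>x \<in> X; y \<in> X\<rbrakk> \<Longrightarrow> x /\<^sub>\<bullet> y \<in> X"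
    and lmul_ldiv: "\<lbrakk>x \<in> X; y \<in> X\<rbrakk> \<Longrightarrow> x \<^bold>\<circ> (x \<setminus>\<^sub>\<circ> y) = y"
    and ldiv_lmul: "\<lbrakk>x \<in> X; y \<in> X\<rbrakk> \<Longrightarrow> x \<setminus>\<^sub>\<circ> (x \<^bold>\<circ> y) = y"
    and rdiv_rmul: "\<lbrakk>x \<in> X; y \<in> X\<rbrakk> \<Longrightarrow> (y /\<^sub>\<bullet> x) \<^bold>\<bullet> x = y"
    and rmul_rdiv: "\<lbrakk>x \<in> X; y \<in> X\<rbrakk> \<Longrightarrow> (y \<^bold>\<bullet> x) /\<^sub>\<bullet> x = y"
    and birack_left: "\<lbrakk>x \<in> X; y \<in> X; z \<in> X\<rbrakk> \<Longrightarrow>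
      x \<^bold>\<circ> (y \<^bold>\<circ> z) = (x \<^bold>\<circ> y) \<^bold>\<circ> ((x \<^bold>\<bullet> y) \<^bold>\<circ> z)"
    and birack_mixed: "\<lbrakk>x \<in> X; y \<in> X; z \<in> X\<rbrakk> \<Longrightarrow>
      (x \<^bold>\<circ> y) \<^bold>\<bullet> ((x \<^bold>\<bullet> y) \<^bold>\<circ> z) = (x \<^bold>\<bullet> (y \<^bold>\<circ> z)) \<^bold>\<circ> (y \<^bold>\<bullet> z)"
    and birack_right: "\<lbrakk>x \<in> X; y \<in> X; z \<in> X\<rbrakk> \<Longrightarrow>
      (x \<^bold>\<bullet> y) \<^bold>\<bullet> z = (x \<^bold>\<bullet> (y \<^bold>\<circ> z)) \<^bold>\<bullet> (y \<^bold>\<bullet> z)"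

definition gen_retraction ::
    "'a set \<Rightarrow> ('a \<Rightarrow> 'a \<Rightarrow> 'a) \<Rightarrow> ('a \<Rightarrow> 'a \<Rightarrow> 'a) \<Rightarrow> ('a \<times> 'a) set" where
  "gen_retraction X lmul rmul =
     {(x, y). x \<in> X \<and> y \<in> X \<and> (\<forall>z\<in>X. lmul x z = lmul y z \<and> rmul z x = rmul z y)}"

definition compatible :: "('a \<times> 'a) set \<Rightarrow> ('a \<Rightarrow> 'a \<Rightarrow> 'a) \<Rightarrow> bool" where
  "compatible r f \<longleftrightarrow>
     (\<forall>a b c d. (a, b) \<in> r \<longrightarrow> (c, d) \<in> r \<longrightarrow> (f a c, f b d) \<in> r)"

definition birack_congruence ::
    "'a set \<Rightarrow> ('a \<Rightarrow> 'a \<Rightarrow> 'a) \<Rightarrow> ('a \<Rightarrow> 'a \<Rightarrow> 'a) \<Rightarrow> ('a \<Rightarrow> 'a \<Rightarrow> 'a) \<Rightarrow> ('a \<Rightarrow> 'a \<Rightarrow> 'a) \<Rightarrow>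
      ('a \<times> 'a) set \<Rightarrow> bool" where
  "birack_congruence X lmul ldiv rmul rdiv r \<longleftrightarrow>
     equiv X r \<and> compatible r lmul \<and> compatible r ldiv \<and> compatible r rmul \<and> compatible r rdiv"

end

theory Submission imports Defs begin

text \<open>
  Write \<open>L\<close> and \<open>R\<close> for the translations. The birack laws read
  \<open>L\<^sub>x L\<^sub>y = L\<^bsub>x\<circ>y\<^esub> L\<^bsub>x\<bullet>y\<^esub>\<close> and \<open>R\<^sub>y R\<^sub>x = R\<^bsub>x\<bullet>y\<^esub> R\<^bsub>x\<circ>y\<^esub>\<close>, so \<open>L\<close> and \<open>R\<close> at \<open>u \<circ> x\<close> are
  determined by those at \<open>x\<close> together with the element \<open>u \<bullet> x\<close>; this gives compatibility with the
  multiplications. For left division put \<open>a = u \ x\<close>, \<open>b = u \ y\<close> with \<open>x \<approx> y\<close>. The same two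
  identities reduce \<open>a \<approx> b\<close> to \<open>u \<bullet> a = u \<bullet> b\<close>, that is, to the equality of the derived shelf operations
  \<open>\<sigma>\<^sub>x(u) = x \<circ> (u \<bullet> (u \ x))\<close> and \<open>\<sigma>\<^sub>y(u)\<close>. Each \<open>L\<^sub>t\<close> is an automorphism of the derived shelf, and
  the diagonal \<open>t \<mapsto> t \ t\<close> is surjective; choosing \<open>t\<close> with \<open>t \<circ> u = t\<close> yields
  \<open>t \<circ> \<sigma>\<^sub>x(u) = (t \<circ> x) \<circ> (t \<bullet> x)\<close>, which depends only on the class of \<open>x\<close>.
  Right division is dual.
\<close>

lemma compatible_swap: "compatible r (\<lambda>x y. f y x) \<Longrightarrow> compatible r f"
  unfolding compatible_def by blast

context birack
begin

lemma lmul_cancel: "\<lbrakk>x \<in> X; y \<in> X; z \<in> X; x \<^bold>\<circ> y = x \<^bold>\<circ> z\<rbrakk> \<Longrightarrow> y = z"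
  by (metis ldiv_lmul)

text \<open>Reading all products backwards exchanges \<open>birack_left\<close> with
  \<open>birack_right\<close> and reverses the sides of \<open>birack_mixed\<close>, so results on
  \<open>lmul\<close> and \<open>ldiv\<close> transfer to \<open>rmul\<close> and
  \<open>rdiv\<close>.\<close>

lemma opposite: "birack X (\<lambda>x y. y \<^bold>\<bullet> x) (\<lambda>x y. y /\<^sub>\<bullet> x) (\<lambda>x y. y \<^bold>\<circ> x) (\<lambda>x y. y \<setminus>\<^sub>\<circ> x)"
proof (rule birack.intro)
  show "X \<noteq> {}" by (rule nonempty)
qed ((rule rmul_closed; assumption),
    (rule rdiv_closed; assumption),
    (rule lmul_closed; assumption),
    (rule ldiv_closed; assumption),
    (rule rdiv_rmul; assumption),
    (rule rmul_rdiv; assumption),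
    (rule lmul_ldiv; assumption),
    (rule ldiv_lmul; assumption),
    (rule birack_right; assumption),
    (rule birack_mixed [symmetric]; assumption),
    (rule birack_left; assumption))

lemma gen_retraction_opposite:
  "gen_retraction X (\<lambda>x y. y \<^bold>\<bullet> x) (\<lambda>x y. y \<^bold>\<circ> x) = gen_retraction X lmul rmul"
  unfolding gen_retraction_def by auto

lemma equiv_gen_retraction: "equiv X (gen_retraction X lmul rmul)"
  unfolding gen_retraction_def by (auto intro!: equivI refl_onI symI transI)

lemma gen_retractionI:
  assumes "x \<in> X" "y \<in> X" "\<And>z. z \<in> X \<Longrightarrow> x \<^bold>\<circ> z = y \<^bold>\<circ> z" "\<And>z. z \<in> X \<Longrightarrow> z \<^bold>\<bullet> x = z \<^bold>\<bullet> y"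
  shows "(x, y) \<in> gen_retraction X lmul rmul"
  using assms by (simp add: gen_retraction_def)

lemma gen_retractionD:
  assumes "(x, y) \<in> gen_retraction X lmul rmul"
  shows "x \<in> X" "y \<in> X" "\<And>z. z \<in> X \<Longrightarrow> x \<^bold>\<circ> z = y \<^bold>\<circ> z" "\<And>z. z \<in> X \<Longrightarrow> z \<^bold>\<bullet> x = z \<^bold>\<bullet> y"
  using assms by (simp_all add: gen_retraction_def)

lemma lmul_gen_retraction:
  assumes xy: "(x, y) \<in> gen_retraction X lmul rmul" and u: "u \<in> X"
  shows "(u \<^bold>\<circ> x, u \<^bold>\<circ> y) \<in> gen_retraction X lmul rmul"
proof -
  note [simp] = gen_retractionD(1,2) [OF xy] u lmul_closed ldiv_closed rmul_closed rdiv_closed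
  note L = gen_retractionD(3) [OF xy] and R = gen_retractionD(4) [OF xy]
  show ?thesis
  proof (rule gen_retractionI)
    fix z assume [simp]: "z \<in> X"
    \<comment> \<open>\<open>w\<close> turns the inner factor of \<open>birack_left\<close> into
      \<open>z\<close>; since \<open>rmul u x = rmul u y\<close>, the same \<open>w\<close> serves
      \<open>y\<close>.\<close>
    define w where "w = (u \<^bold>\<bullet> x) \<setminus>\<^sub>\<circ> z"
    have [simp]: "w \<in> X" and w: "(u \<^bold>\<bullet> x) \<^bold>\<circ> w = z" by (simp_all add: w_def lmul_ldiv)
    show "(u \<^bold>\<circ> x) \<^bold>\<circ> z = (u \<^bold>\<circ> y) \<^bold>\<circ> z"
      using birack_left [of u x w] birack_left [of u y w] w by (simp add: L R)
    show "z \<^bold>\<bullet> (u \<^bold>\<circ> x) = z \<^bold>\<bullet> (u \<^bold>\<circ> y)"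
    proof -
      have "(z \<^bold>\<bullet> (u \<^bold>\<circ> x)) \<^bold>\<bullet> (u \<^bold>\<bullet> x) = (z \<^bold>\<bullet> (u \<^bold>\<circ> y)) \<^bold>\<bullet> (u \<^bold>\<bullet> x)"
        using birack_right [of z u x] birack_right [of z u y] by (simp add: R)
      then show ?thesis
        by (metis rmul_rdiv \<open>z \<in> X\<close> u gen_retractionD(1,2) [OF xy] lmul_closed rmul_closed)
    qed
  qed simp_all
qed

lemma ex_left_fixing:
  assumes "w \<in> X"
  obtains t where "t \<in> X" "t \<^bold>\<circ> w = t"
proof
  \<comment> \<open>Here \<open>rmul ?p w = w\<close>, so both inner factors in
    \<open>birack_left\<close> at \<open>?p\<close>, \<open>w\<close>, \<open>ldiv w w\<close>
    reduce to \<open>w\<close>.\<close>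
  let ?p = "w /\<^sub>\<bullet> w"
  show "?p \<^bold>\<circ> w \<in> X" using assms by (simp add: lmul_closed rdiv_closed)
  show "?p \<^bold>\<circ> w \<^bold>\<circ> w = ?p \<^bold>\<circ> w"
    using birack_left [of ?p w "w \<setminus>\<^sub>\<circ> w"] assms
    by (simp add: rdiv_closed ldiv_closed rdiv_rmul lmul_ldiv)
qed

lemma derived_shelf_at_left_fixing:
  assumes t: "t \<in> X" and w: "w \<in> X" and x: "x \<in> X" and fixing: "t \<^bold>\<circ> w = t"
  shows "t \<^bold>\<circ> (x \<^bold>\<circ> (w \<^bold>\<bullet> (w \<setminus>\<^sub>\<circ> x))) = (t \<^bold>\<circ> x) \<^bold>\<circ> (t \<^bold>\<bullet> x)"
proof -
  note [simp] = t w x lmul_closed ldiv_closed rmul_closed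
  let ?v = "w \<setminus>\<^sub>\<circ> x"
  have wv: "w \<^bold>\<circ> ?v = x" by (simp add: lmul_ldiv)
  have "t \<^bold>\<circ> x = t \<^bold>\<circ> ((t \<^bold>\<bullet> w) \<^bold>\<circ> ?v)"
    using birack_left [of t w ?v] by (simp add: wv fixing)
  then have s: "(t \<^bold>\<bullet> w) \<^bold>\<circ> ?v = x" using lmul_cancel [of t] by simp
  have "t \<^bold>\<circ> (x \<^bold>\<circ> (w \<^bold>\<bullet> ?v)) = (t \<^bold>\<circ> x) \<^bold>\<circ> ((t \<^bold>\<bullet> x) \<^bold>\<circ> (w \<^bold>\<bullet> ?v))"
    by (rule birack_left) simp_all
  \<comment> \<open>As \<open>lmul t w = t\<close> and by \<open>s\<close>, the left side of
    \<open>birack_mixed\<close> is just \<open>rmul t x\<close>.\<close>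
  also have "(t \<^bold>\<bullet> x) \<^bold>\<circ> (w \<^bold>\<bullet> ?v) = t \<^bold>\<bullet> x"
    using birack_mixed [of t w ?v] by (simp add: wv s fixing)
  finally show ?thesis .
qed

lemma rmul_ldiv_gen_retraction:
  assumes xy: "(x, y) \<in> gen_retraction X lmul rmul" and u: "u \<in> X"
  shows "u \<^bold>\<bullet> (u \<setminus>\<^sub>\<circ> x) = u \<^bold>\<bullet> (u \<setminus>\<^sub>\<circ> y)"
proof -
  note [simp] = gen_retractionD(1,2) [OF xy] u lmul_closed ldiv_closed rmul_closed
  obtain t where [simp]: "t \<in> X" and t: "t \<^bold>\<circ> u = t" by (rule ex_left_fixing [OF u])
  have "t \<^bold>\<circ> (x \<^bold>\<circ> (u \<^bold>\<bullet> (u \<setminus>\<^sub>\<circ> x))) = (t \<^bold>\<circ> x) \<^bold>\<circ> (t \<^bold>\<bullet> x)"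
    by (simp add: derived_shelf_at_left_fixing t)
  \<comment> \<open>\<open>lmul t x\<close> and \<open>lmul t y\<close> are again related, hence
    have equal left translations, and \<open>rmul t x = rmul t y\<close>.\<close>
  also have "\<dots> = (t \<^bold>\<circ> y) \<^bold>\<circ> (t \<^bold>\<bullet> y)"
    using gen_retractionD(3) [OF lmul_gen_retraction [OF xy \<open>t \<in> X\<close>]] gen_retractionD(4) [OF xy]
    by simp
  also have "\<dots> = t \<^bold>\<circ> (y \<^bold>\<circ> (u \<^bold>\<bullet> (u \<setminus>\<^sub>\<circ> y)))"
    by (simp add: derived_shelf_at_left_fixing t)
  finally have "x \<^bold>\<circ> (u \<^bold>\<bullet> (u \<setminus>\<^sub>\<circ> x)) = y \<^bold>\<circ> (u \<^bold>\<bullet> (u \<setminus>\<^sub>\<circ> y))"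
    using lmul_cancel [of t] by simp
  then have "y \<^bold>\<circ> (u \<^bold>\<bullet> (u \<setminus>\<^sub>\<circ> x)) = y \<^bold>\<circ> (u \<^bold>\<bullet> (u \<setminus>\<^sub>\<circ> y))"
    using gen_retractionD(3) [OF xy] by simp
  then show ?thesis using lmul_cancel [of y] by simp
qed

lemma ldiv_gen_retraction:
  assumes xy: "(x, y) \<in> gen_retraction X lmul rmul" and u: "u \<in> X"
  shows "(u \<setminus>\<^sub>\<circ> x, u \<setminus>\<^sub>\<circ> y) \<in> gen_retraction X lmul rmul"
proof -
  note [simp] = gen_retractionD(1,2) [OF xy] u lmul_closed ldiv_closed rmul_closed rdiv_closed
  note L = gen_retractionD(3) [OF xy] and R = gen_retractionD(4) [OF xy]
  note p = rmul_ldiv_gen_retraction [OF xy u]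
  show ?thesis
  proof (rule gen_retractionI)
    fix z assume [simp]: "z \<in> X"
    have "u \<^bold>\<circ> ((u \<setminus>\<^sub>\<circ> x) \<^bold>\<circ> z) = u \<^bold>\<circ> ((u \<setminus>\<^sub>\<circ> y) \<^bold>\<circ> z)"
      using birack_left [of u "u \<setminus>\<^sub>\<circ> x" z] birack_left [of u "u \<setminus>\<^sub>\<circ> y" z]
      by (simp add: lmul_ldiv p L)
    then show "(u \<setminus>\<^sub>\<circ> x) \<^bold>\<circ> z = (u \<setminus>\<^sub>\<circ> y) \<^bold>\<circ> z" using lmul_cancel [of u] by simp
    show "z \<^bold>\<bullet> (u \<setminus>\<^sub>\<circ> x) = z \<^bold>\<bullet> (u \<setminus>\<^sub>\<circ> y)"
      \<comment> \<open>Writing \<open>z\<close> as \<open>rmul (rdiv z u) u\<close> makes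
        \<open>birack_right\<close> applicable.\<close>
      using birack_right [of "z /\<^sub>\<bullet> u" u "u \<setminus>\<^sub>\<circ> x"] birack_right [of "z /\<^sub>\<bullet> u" u "u \<setminus>\<^sub>\<circ> y"]
      by (simp add: lmul_ldiv rdiv_rmul p R)
  qed simp_all
qed

lemma compatible_lmul: "compatible (gen_retraction X lmul rmul) lmul"
  unfolding compatible_def
proof (intro allI impI)
  fix a b c d
  assume ab: "(a, b) \<in> gen_retraction X lmul rmul" and cd: "(c, d) \<in> gen_retraction X lmul rmul"
  show "(a \<^bold>\<circ> c, b \<^bold>\<circ> d) \<in> gen_retraction X lmul rmul"
    using lmul_gen_retraction [OF cd gen_retractionD(2) [OF ab]]
      gen_retractionD(3) [OF ab gen_retractionD(1) [OF cd]] by simp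
qed

lemma compatible_ldiv: "compatible (gen_retraction X lmul rmul) ldiv"
  unfolding compatible_def
proof (intro allI impI)
  fix a b c d
  assume ab: "(a, b) \<in> gen_retraction X lmul rmul" and cd: "(c, d) \<in> gen_retraction X lmul rmul"
  \<comment> \<open>Both sides equal \<open>c\<close>, because \<open>a\<close> and \<open>b\<close>
    have the same left translation.\<close>
  have "b \<^bold>\<circ> (a \<setminus>\<^sub>\<circ> c) = b \<^bold>\<circ> (b \<setminus>\<^sub>\<circ> c)"
    using gen_retractionD [OF ab] gen_retractionD(1) [OF cd] by (metis lmul_ldiv ldiv_closed)
  then have "a \<setminus>\<^sub>\<circ> c = b \<setminus>\<^sub>\<circ> c"
    using lmul_cancel gen_retractionD(1,2) [OF ab] gen_retractionD(1) [OF cd] ldiv_closed by blast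
  then show "(a \<setminus>\<^sub>\<circ> c, b \<setminus>\<^sub>\<circ> d) \<in> gen_retraction X lmul rmul"
    using ldiv_gen_retraction [OF cd gen_retractionD(2) [OF ab]] by simp
qed

end

theorem theorem3p3:
  fixes X :: "'a set" and lmul ldiv rmul rdiv :: "'a \<Rightarrow> 'a \<Rightarrow> 'a"
  assumes "birack X lmul ldiv rmul rdiv"
  shows "birack_congruence X lmul ldiv rmul rdiv (gen_retraction X lmul rmul)"
proof -
  interpret birack X lmul ldiv rmul rdiv by fact
  interpret op: birack X "\<lambda>x y. rmul y x" "\<lambda>x y. rdiv y x" "\<lambda>x y. lmul y x" "\<lambda>x y. ldiv y x"
    by (rule opposite)
  show ?thesis
    using equiv_gen_retraction compatible_lmul compatible_ldiv
      op.compatible_lmul [unfolded gen_retraction_opposite, THEN compatible_swap]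
      op.compatible_ldiv [unfolded gen_retraction_opposite, THEN compatible_swap]
    by (simp add: birack_congruence_def)
qed

end
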